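(* Let $N\ge 2$ and, for each $i\in\{1,\dots,N-1\}$, let $\mathcal G_i$ be a set of unitary operators on $(\mathbb C^2)^{\otimes N}$ acting nontrivially only on spins $i,i+1$. Assume that the gates allow for a fusion operation (for every $i$ and all $g,g'\in\mathcal G_i$, $gg'\in\mathcal G_i$) and for a turnover operation (for every $i\in\{1,\dots,N-2\}$: for all $g_1,g_3\in\mathcal G_i$, $g_2\in\mathcal G_{i+1}$ there are $g_a,g_c\in\mathcal G_{i+1}$, $g_b\in\mathcal G_i$ with $g_1g_2g_3=g_ag_bg_c$, and conversely for all $g_a,g_c\in\mathcal G_{i+1}$, $g_b\in\mathcal G_i$ there are $g_1,g_3\in\mathcal G_i$, $g_2\in\mathcal G_{i+1}$ with $g_ag_bg_c=g_1g_2g_3$). Then the following hold. (1) Square circuits and triangle circuits on $N$ spins both contain $N(N-1)/2$ gates. Every square circuit is equal (as an operator) to a triangle circuit and vice versa, and either conversion can be carried out with $O(N^3)$ turnover operations (besides reordering gates that act on disjoint spins). (2) If $T$ is the operator of a triangle circuit and $g\in\mathcal G_i$ for some $i$, then both $gT$ and $Tg$ are equal to the operator of a triangle circuit, which can be obtained from the given one with $O(N)$ turnover operations and one fusion operation. Consequently, a product of an odd layer and an even layer can be merged into a triangle circuit with $O(N^2)$ turnover and fusion operations. (3) Let $n_t>N/2$ be an integer. Every circuit consisting of $2n_t$ layers, which are in time order alternately odd layers and even layers, beginning with an odd layer, is equal as an operator to a square circuit on $N$ spins (hence of depth $N$, independent of $n_t$), and this square circuit can be computed with $O(N^3+n_tN^2)$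 turnover and fusion operations.
   Context: Spins are numbered $1,\dots,N$; the state space is $(\mathbb C^2)^{\otimes N}$. A circuit is a finite time-ordered sequence of gates $g_1,g_2,\dots,g_m$ (first to last), each $g_k$ lying in some $\mathcal G_{i_k}$ (a gate "at position $i_k$"); its operator is the product $g_m\cdots g_2g_1$. Gates at positions $i,j$ with $|i-j|\ge 2$ act on disjoint spins and therefore commute. An odd layer consists of one gate at each odd position $i\in\{1,\dots,N-1\}$; an even layer consists of one gate at each even position $i\in\{1,\dots,N-1\}$. The gates in one layer act on disjoint spins, so a layer has depth one. A square circuit on $N$ spins is a circuit with $N$ layers, in time order alternately odd and even layers, the first being odd. A triangle circuit on $N$ spins consists, in time order, of $N-1$ descending cascades; for $k=1,\dots,N-1$ the $k$-th cascade contains $k$ gates, at positions $N-k,\,N-k+1,\,\dots,\,N-1$ in this time order. A turnover operation is one replacement of three consecutive gates $g_1g_2g_3$ at positions $i,i+1,i$ by $g_ag_bg_c$ at positions $i+1,i,i+1$ or the reverse; a fusion operation is one replacement of two consecutive gates at the same position by their product. The $O(\cdot)$ constants are absolute. *)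

theory Defs
  imports "Jordan_Normal_Form.Schur_Decomposition"
begin

text \<open>
  Operators on the state space of \<open>N\<close> spins are complex matrices of dimension \<open>2 ^ N\<close>, written in
  the product basis ordered so that tensor products become Kronecker products and spin 1 is the
  leftmost tensor factor.
\<close>

definition kron :: "complex mat \<Rightarrow> complex mat \<Rightarrow> complex mat"  (infixr "\<otimes>\<^sub>K" 70) where
  "A \<otimes>\<^sub>K B = mat (dim_row A * dim_row B) (dim_col A * dim_col B)
     (\<lambda>(r, c). A $$ (r div dim_row B, c div dim_col B) * B $$ (r mod dim_row B, c mod dim_col B))"

definition unitary_mat :: "nat \<Rightarrow> complex mat \<Rightarrow> bool" where
  "unitary_mat n U \<longleftrightarrow> U \<in> carrier_mat n n \<and> mat_adjoint U * U = 1\<^sub>m n \<and> U * mat_adjoint U = 1\<^sub>m n"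

definition acts_only_on_pair :: "nat \<Rightarrow> nat \<Rightarrow> complex mat \<Rightarrow> bool" where
  "acts_only_on_pair N i U \<longleftrightarrow>
     (\<exists>u \<in> carrier_mat 4 4. U = 1\<^sub>m (2 ^ (i - 1)) \<otimes>\<^sub>K u \<otimes>\<^sub>K 1\<^sub>m (2 ^ (N - i - 1)))"

definition gate_family :: "nat \<Rightarrow> (nat \<Rightarrow> complex mat set) \<Rightarrow> bool" where
  "gate_family N G \<longleftrightarrow>
     (\<forall>i \<in> {1..N - 1}. \<forall>g \<in> G i. unitary_mat (2 ^ N) g \<and> acts_only_on_pair N i g)"

definition allows_fusion :: "nat \<Rightarrow> (nat \<Rightarrow> complex mat set) \<Rightarrow> bool" where
  "allows_fusion N G \<longleftrightarrow> (\<forall>i \<in> {1..N - 1}. \<forall>g \<in> G i. \<forall>g' \<in> G i. g * g' \<in> G i)"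

definition allows_turnover :: "nat \<Rightarrow> (nat \<Rightarrow> complex mat set) \<Rightarrow> bool" where
  "allows_turnover N G \<longleftrightarrow> (\<forall>i \<in> {1..N - 2}.
     (\<forall>g1 \<in> G i. \<forall>g2 \<in> G (i + 1). \<forall>g3 \<in> G i.
        \<exists>ga \<in> G (i + 1). \<exists>gb \<in> G i. \<exists>gc \<in> G (i + 1). g1 * g2 * g3 = ga * gb * gc) \<and>
     (\<forall>ga \<in> G (i + 1). \<forall>gb \<in> G i. \<forall>gc \<in> G (i + 1).
        \<exists>g1 \<in> G i. \<exists>g2 \<in> G (i + 1). \<exists>g3 \<in> G i. ga * gb * gc = g1 * g2 * g3))"


text \<open>
  A circuit lists its gates, each with its position, in time order. The list order is thus the
  reverse of the order in which the gates appear in the operator product.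
\<close>

type_synonym circuit = "(nat \<times> complex mat) list"

definition is_circuit :: "nat \<Rightarrow> (nat \<Rightarrow> complex mat set) \<Rightarrow> circuit \<Rightarrow> bool" where
  "is_circuit N G c \<longleftrightarrow> (\<forall>(i, g) \<in> set c. i \<in> {1..N - 1} \<and> g \<in> G i)"

fun circuit_op :: "nat \<Rightarrow> circuit \<Rightarrow> complex mat" where
  "circuit_op N [] = 1\<^sub>m (2 ^ N)"
| "circuit_op N ((i, g) # c) = circuit_op N c * g"

text \<open>The gates of a layer act on disjoint spins, so they may be listed in any order.\<close>

definition odd_layer :: "nat \<Rightarrow> (nat \<Rightarrow> complex mat set) \<Rightarrow> circuit \<Rightarrow> bool" where
  "odd_layer N G c \<longleftrightarrow> is_circuit N G c \<and> distinct (map fst c) \<and>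
     set (map fst c) = {i \<in> {1..N - 1}. odd i}"

definition even_layer :: "nat \<Rightarrow> (nat \<Rightarrow> complex mat set) \<Rightarrow> circuit \<Rightarrow> bool" where
  "even_layer N G c \<longleftrightarrow> is_circuit N G c \<and> distinct (map fst c) \<and>
     set (map fst c) = {i \<in> {1..N - 1}. even i}"

text \<open>List indices start at 0, so the odd layers sit at the even indices.\<close>

definition alternating_circuit ::
    "nat \<Rightarrow> (nat \<Rightarrow> complex mat set) \<Rightarrow> nat \<Rightarrow> circuit \<Rightarrow> bool" where
  "alternating_circuit N G n c \<longleftrightarrow> (\<exists>ls. length ls = n \<and> c = concat ls \<and>
     (\<forall>k < n. if even k then odd_layer N G (ls ! k) else even_layer N G (ls ! k)))"

definition square_circuit :: "nat \<Rightarrow> (nat \<Rightarrow> complex mat set) \<Rightarrow> circuit \<Rightarrow> bool" where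
  "square_circuit N G c \<longleftrightarrow> alternating_circuit N G N c"

definition triangle_circuit :: "nat \<Rightarrow> (nat \<Rightarrow> complex mat set) \<Rightarrow> circuit \<Rightarrow> bool" where
  "triangle_circuit N G c \<longleftrightarrow> is_circuit N G c \<and>
     map fst c = concat (map (\<lambda>k. [N - k..<N]) [1..<N])"

definition disjoint_spins :: "nat \<Rightarrow> nat \<Rightarrow> bool" where
  "disjoint_spins i j \<longleftrightarrow> i + 2 \<le> j \<or> j + 2 \<le> i"

text \<open>
  Empty groups of gates are allowed because the even layer is empty for two spins.
\<close>

definition arranged_in_depth :: "nat \<Rightarrow> circuit \<Rightarrow> bool" where
  "arranged_in_depth d c \<longleftrightarrow> (\<exists>ls. length ls = d \<and> c = concat ls \<and>
     (\<forall>l \<in> set ls. sorted_wrt disjoint_spins (map fst l)))"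


inductive reorder_step :: "circuit \<Rightarrow> circuit \<Rightarrow> bool" where
  "disjoint_spins i j \<Longrightarrow>
     reorder_step (xs @ [(i, g), (j, h)] @ ys) (xs @ [(j, h), (i, g)] @ ys)"

inductive turnover_step :: "(nat \<Rightarrow> complex mat set) \<Rightarrow> circuit \<Rightarrow> circuit \<Rightarrow> bool"
  for G where
  up: "\<lbrakk>g1 \<in> G i; g2 \<in> G (i + 1); g3 \<in> G i; ga \<in> G (i + 1); gb \<in> G i; gc \<in> G (i + 1);
        g3 * g2 * g1 = gc * gb * ga\<rbrakk> \<Longrightarrow>
     turnover_step G (xs @ [(i, g1), (i + 1, g2), (i, g3)] @ ys)
                     (xs @ [(i + 1, ga), (i, gb), (i + 1, gc)] @ ys)"
| down: "\<lbrakk>ga \<in> G (i + 1); gb \<in> G i; gc \<in> G (i + 1); g1 \<in> G i; g2 \<in> G (i + 1); g3 \<in> G i;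
        gc * gb * ga = g3 * g2 * g1\<rbrakk> \<Longrightarrow>
     turnover_step G (xs @ [(i + 1, ga), (i, gb), (i + 1, gc)] @ ys)
                     (xs @ [(i, g1), (i + 1, g2), (i, g3)] @ ys)"

inductive fusion_step :: "circuit \<Rightarrow> circuit \<Rightarrow> bool" where
  "fusion_step (xs @ [(i, g), (i, h)] @ ys) (xs @ [(i, h * g)] @ ys)"

text \<open>
  \<open>converts G a b c c'\<close>: the circuit \<open>c\<close> can be turned into \<open>c'\<close> by exactly \<open>a\<close> turnover
  operations and \<open>b\<close> fusion operations; reordering gates on disjoint spins is not counted.
\<close>

inductive converts ::
    "(nat \<Rightarrow> complex mat set) \<Rightarrow> nat \<Rightarrow> nat \<Rightarrow> circuit \<Rightarrow> circuit \<Rightarrow> bool"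
  for G where
  refl: "converts G 0 0 c c"
| reorder: "\<lbrakk>converts G a b c d; reorder_step d e\<rbrakk> \<Longrightarrow> converts G a b c e"
| turnover: "\<lbrakk>converts G a b c d; turnover_step G d e\<rbrakk> \<Longrightarrow> converts G (Suc a) b c e"
| fusion: "\<lbrakk>converts G a b c d; fusion_step d e\<rbrakk> \<Longrightarrow> converts G a (Suc b) c e"

end

(*
  Only the positions of the gates matter for the conversions. The cascade D_m = (m, ..., N-1) carries
  a later gate at i with m <= i < N-1 over to an earlier gate at i+1 with a single turnover.

  A triangle is D_{N-1} ... D_1. A gate appended to it moves leftwards through the cascades, its
  position rising until it meets the last letter of a cascade and fuses. A gate at i prepended to it
  commutes up to the factor D_{i+1} D_i, turns it into D_i D_i, and is fused there. In a square the
  diagonal gates at 1, 2, ..., N-1 form D_1; the gates after the diagonal pass through D_1 and fill up the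
  gates before it to a square on the spins 2, ..., N, so that induction yields the triangle.
*)
theory Submission
  imports Defs
begin

section \<open>Commuting gates\<close>

lemma dim_kron [simp]:
  "dim_row (A \<otimes>\<^sub>K B) = dim_row A * dim_row B" "dim_col (A \<otimes>\<^sub>K B) = dim_col A * dim_col B"
  by (simp_all add: kron_def)

lemma kron_carrier [intro]:
  "A \<in> carrier_mat a b \<Longrightarrow> B \<in> carrier_mat c d \<Longrightarrow> A \<otimes>\<^sub>K B \<in> carrier_mat (a * c) (b * d)"
  by (simp add: kron_def)

lemma index_kron:
  "r < dim_row A * dim_row B \<Longrightarrow> c < dim_col A * dim_col B \<Longrightarrow>
    (A \<otimes>\<^sub>K B) $$ (r, c) =
      A $$ (r div dim_row B, c div dim_col B) * B $$ (r mod dim_row B, c mod dim_col B)"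
  by (simp add: kron_def)

lemma div_mod_less_mult:
  fixes r m n :: nat
  assumes "r < m * n"
  shows "r div n < m" "r mod n < n"
  using assms by (simp_all add: less_mult_imp_div_less mod_less_divisor gr0_conv_Suc)
    (metis mod_less_divisor mult_0_right not_gr_zero not_less_zero)

lemma sum_div_mod:
  fixes f :: "nat \<Rightarrow> nat \<Rightarrow> 'a::comm_monoid_add"
  shows "(\<Sum>k<m * n. f (k div n) (k mod n)) = (\<Sum>i<m. \<Sum>j<n. f i j)"
proof -
  have "(\<Sum>k<m * n. f (k div n) (k mod n)) = (\<Sum>i<m. \<Sum>k = i * n..<i * n + n. f (k div n) (k mod n))"
    by (rule sum.nat_group [symmetric])
  also have "\<dots> = (\<Sum>i<m. \<Sum>j<n. f i j)"
  proof (rule sum.cong [OF HOL.refl])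
    fix i
    have "(\<Sum>k = i * n..<i * n + n. f (k div n) (k mod n)) =
        (\<Sum>j = 0..<n. f ((j + i * n) div n) ((j + i * n) mod n))"
      using sum.shift_bounds_nat_ivl [of "\<lambda>k. f (k div n) (k mod n)" 0 "i * n" n]
      by (simp add: add.commute)
    also have "\<dots> = (\<Sum>j<n. f i j)"
      by (rule sum.cong) auto
    finally show "(\<Sum>k = i * n..<i * n + n. f (k div n) (k mod n)) = (\<Sum>j<n. f i j)" .
  qed
  finally show ?thesis .
qed

lemma kron_mult:
  assumes A: "A \<in> carrier_mat a b" and C: "C \<in> carrier_mat b c"
    and B: "B \<in> carrier_mat d e" and D: "D \<in> carrier_mat e f"
  shows "(A \<otimes>\<^sub>K B) * (C \<otimes>\<^sub>K D) = (A * C) \<otimes>\<^sub>K (B * D)"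
proof (rule eq_matI)
  fix r s
  assume "r < dim_row ((A * C) \<otimes>\<^sub>K (B * D))" and "s < dim_col ((A * C) \<otimes>\<^sub>K (B * D))"
  with assms have r: "r < a * d" and s: "s < c * f" by auto
  note rs = div_mod_less_mult [OF r] div_mod_less_mult [OF s]
  have "((A \<otimes>\<^sub>K B) * (C \<otimes>\<^sub>K D)) $$ (r, s) =
      (\<Sum>k<b * e. (A \<otimes>\<^sub>K B) $$ (r, k) * (C \<otimes>\<^sub>K D) $$ (k, s))"
    using assms r s by (simp add: scalar_prod_def atLeast0LessThan)
  also have "\<dots> = (\<Sum>k<b * e. A $$ (r div d, k div e) * B $$ (r mod d, k mod e) *
      (C $$ (k div e, s div f) * D $$ (k mod e, s mod f)))"
    using assms r s by (intro sum.cong) (auto simp: index_kron)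
  also have "\<dots> = (\<Sum>i<b. \<Sum>j<e. A $$ (r div d, i) * B $$ (r mod d, j) *
      (C $$ (i, s div f) * D $$ (j, s mod f)))"
    by (rule sum_div_mod)
  also have "\<dots> = (\<Sum>i<b. A $$ (r div d, i) * C $$ (i, s div f)) *
      (\<Sum>j<e. B $$ (r mod d, j) * D $$ (j, s mod f))"
    unfolding sum_product by (simp add: mult_ac)
  also have "\<dots> = (A * C) $$ (r div d, s div f) * (B * D) $$ (r mod d, s mod f)"
    using assms rs by (simp add: scalar_prod_def atLeast0LessThan)
  also have "\<dots> = ((A * C) \<otimes>\<^sub>K (B * D)) $$ (r, s)"
    using assms r s by (subst index_kron) auto
  finally show "((A \<otimes>\<^sub>K B) * (C \<otimes>\<^sub>K D)) $$ (r, s) = ((A * C) \<otimes>\<^sub>K (B * D)) $$ (r, s)" .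
qed (use assms in auto)

lemma div_mod_swap:
  fixes r m n :: nat
  shows "r mod (m * n) div n = r div n mod m" "r mod (m * n) mod n = r mod n"
proof -
  have *: "r mod (m * n) = n * (r div n mod m) + r mod n"
    using mod_mult2_eq [of r n m] by (simp add: mult.commute)
  show "r mod (m * n) div n = r div n mod m"
    by (cases "n = 0") (simp_all add: *)
  show "r mod (m * n) mod n = r mod n"
    by (simp add: *)
qed

lemma kron_assoc: "(A \<otimes>\<^sub>K B) \<otimes>\<^sub>K C = A \<otimes>\<^sub>K (B \<otimes>\<^sub>K C)"
proof (rule eq_matI)
  fix r s
  assume "r < dim_row (A \<otimes>\<^sub>K (B \<otimes>\<^sub>K C))" and "s < dim_col (A \<otimes>\<^sub>K (B \<otimes>\<^sub>K C))"
  then have r: "r < dim_row A * dim_row B * dim_row C" and s: "s < dim_col A * dim_col B * dim_col C"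
    by (simp_all add: mult.assoc)
  note rs = div_mod_less_mult [OF r] div_mod_less_mult [OF s]
  have rs': "r mod (dim_row B * dim_row C) < dim_row B * dim_row C"
      "s mod (dim_col B * dim_col C) < dim_col B * dim_col C"
    using div_mod_less_mult(2) [of r "dim_row A"] div_mod_less_mult(2) [of s "dim_col A"] r s
    by (simp_all add: mult.assoc)
  show "((A \<otimes>\<^sub>K B) \<otimes>\<^sub>K C) $$ (r, s) = (A \<otimes>\<^sub>K (B \<otimes>\<^sub>K C)) $$ (r, s)"
    using r s rs rs'
    by (simp add: index_kron mult.assoc [symmetric] div_mod_swap div_mult2_eq [symmetric])
      (simp add: mult.assoc index_kron div_mod_swap div_mult2_eq mult.commute [of "dim_row B"] mult.commute [of "dim_col B"])
qed (simp_all add: mult.assoc)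

lemma kron_one: "1\<^sub>m m \<otimes>\<^sub>K 1\<^sub>m n = 1\<^sub>m (m * n)"
proof (rule eq_matI)
  fix r s
  assume "r < dim_row (1\<^sub>m (m * n) :: complex mat)" "s < dim_col (1\<^sub>m (m * n) :: complex mat)"
  then have r: "r < m * n" and s: "s < m * n" by auto
  have "r div n = s div n \<and> r mod n = s mod n \<longleftrightarrow> r = s"
    by (metis div_mult_mod_eq)
  then show "((1\<^sub>m m \<otimes>\<^sub>K 1\<^sub>m n) :: complex mat) $$ (r, s) = 1\<^sub>m (m * n) $$ (r, s)"
    using r s div_mod_less_mult [OF r] div_mod_less_mult [OF s] by (auto simp: index_kron)
qed auto

lemma kron_factors_commute:
  assumes A: "A \<in> carrier_mat m m" and B: "B \<in> carrier_mat n n"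
  shows "(A \<otimes>\<^sub>K 1\<^sub>m n) * (1\<^sub>m m \<otimes>\<^sub>K B) = (1\<^sub>m m \<otimes>\<^sub>K B) * (A \<otimes>\<^sub>K 1\<^sub>m n)"
  using kron_mult [OF A one_carrier_mat one_carrier_mat B]
    kron_mult [OF one_carrier_mat A B one_carrier_mat] A B by simp

lemma disjoint_gates_commute:
  assumes g: "acts_only_on_pair N i g" and h: "acts_only_on_pair N j h"
    and i: "1 \<le> i" and ij: "i + 2 \<le> j" and j: "j < N"
  shows "g * h = h * g"
proof -
  obtain u where u: "u \<in> carrier_mat 4 4" and
    gu: "g = 1\<^sub>m (2 ^ (i - 1)) \<otimes>\<^sub>K u \<otimes>\<^sub>K 1\<^sub>m (2 ^ (N - i - 1))"
    using g by (auto simp: acts_only_on_pair_def)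
  obtain v where v: "v \<in> carrier_mat 4 4" and
    hv: "h = 1\<^sub>m (2 ^ (j - 1)) \<otimes>\<^sub>K v \<otimes>\<^sub>K 1\<^sub>m (2 ^ (N - j - 1))"
    using h by (auto simp: acts_only_on_pair_def)
  define A where "A = 1\<^sub>m (2 ^ (i - 1)) \<otimes>\<^sub>K u"
  define B where "B = 1\<^sub>m (2 ^ (j - i - 2)) \<otimes>\<^sub>K v \<otimes>\<^sub>K 1\<^sub>m (2 ^ (N - j - 1))"
  have four: "(4::nat) = 2 ^ 2" by simp
  have dim_A: "(2::nat) ^ (i - 1) * 4 = 2 ^ (i + 1)"
    unfolding four power_add [symmetric] using i by simp
  have A: "A \<in> carrier_mat (2 ^ (i + 1)) (2 ^ (i + 1))"
    using kron_carrier [OF one_carrier_mat u, of "2 ^ (i - 1)"] by (simp only: A_def dim_A)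
  have dim_B: "(2::nat) ^ (j - i - 2) * (4 * 2 ^ (N - j - 1)) = 2 ^ (N - i - 1)"
    unfolding four power_add [symmetric] using ij j by (intro arg_cong [of _ _ "power 2"]) linarith
  have B: "B \<in> carrier_mat (2 ^ (N - i - 1)) (2 ^ (N - i - 1))"
    using kron_carrier [OF one_carrier_mat kron_carrier [OF v one_carrier_mat],
        of "2 ^ (j - i - 2)" "2 ^ (N - j - 1)"] by (simp only: B_def dim_B)
  have "(2::nat) ^ (j - 1) = 2 ^ (i + 1) * 2 ^ (j - i - 2)"
    unfolding power_add [symmetric] using ij by (intro arg_cong [of _ _ "power 2"]) linarith
  then have "h = 1\<^sub>m (2 ^ (i + 1)) \<otimes>\<^sub>K B"
    by (simp only: hv B_def kron_one [symmetric] kron_assoc)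
  moreover have "g = A \<otimes>\<^sub>K 1\<^sub>m (2 ^ (N - i - 1))"
    by (simp only: gu A_def kron_assoc)
  ultimately show ?thesis
    using kron_factors_commute [OF A B] by simp
qed

section \<open>Circuits and words of positions\<close>

lemma is_circuit_simps [simp]:
  "is_circuit N G []"
  "is_circuit N G ((i, g) # c) \<longleftrightarrow> i \<in> {1..N - 1} \<and> g \<in> G i \<and> is_circuit N G c"
  "is_circuit N G (c @ d) \<longleftrightarrow> is_circuit N G c \<and> is_circuit N G d"
  by (auto simp: is_circuit_def)

lemma converts_trans:
  assumes "converts G a' b' d e" "converts G a b c d"
  shows "converts G (a + a') (b + b') c e"
  using assms by induction (auto intro: converts.intros)

lemma reorder_step_context: "reorder_step c d \<Longrightarrow> reorder_step (xs @ c @ ys) (xs @ d @ ys)"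
  by (induction rule: reorder_step.induct)
    (metis (no_types, lifting) append.assoc reorder_step.intros)

lemma turnover_step_context:
  "turnover_step G c d \<Longrightarrow> turnover_step G (xs @ c @ ys) (xs @ d @ ys)"
proof (induction rule: turnover_step.induct)
  case (up g1 i g2 g3 ga gb gc us vs)
  then show ?case
    using turnover_step.up [of g1 G i g2 g3 ga gb gc "xs @ us" "vs @ ys"] by simp
next
  case (down ga i gb gc g1 g2 g3 us vs)
  then show ?case
    using turnover_step.down [of ga G i gb gc g1 g2 g3 "xs @ us" "vs @ ys"] by simp
qed

lemma fusion_step_context: "fusion_step c d \<Longrightarrow> fusion_step (xs @ c @ ys) (xs @ d @ ys)"
  by (induction rule: fusion_step.induct)
    (metis (no_types, lifting) append.assoc fusion_step.intros)

lemma converts_context: "converts G a b c d \<Longrightarrow> converts G a b (xs @ c @ ys) (xs @ d @ ys)"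
  by (induction rule: converts.induct)
    (auto intro: converts.intros reorder_step_context turnover_step_context fusion_step_context)

lemma converts_length: "converts G a b c d \<Longrightarrow> length c = length d + b"
  by (induction rule: converts.induct)
    (auto elim!: reorder_step.cases turnover_step.cases fusion_step.cases)

locale gate_circuits =
  fixes N :: nat and G :: "nat \<Rightarrow> complex mat set"
  assumes two_le: "2 \<le> N"
    and family: "gate_family N G"
    and fusion: "allows_fusion N G"
    and turnover: "allows_turnover N G"
begin

lemma gate_carrier: "i \<in> {1..N - 1} \<Longrightarrow> g \<in> G i \<Longrightarrow> g \<in> carrier_mat (2 ^ N) (2 ^ N)"
  using family by (auto simp: gate_family_def unitary_mat_def)

lemma gates_commute:
  assumes "disjoint_spins i j" "i \<in> {1..N - 1}" "j \<in> {1..N - 1}" "g \<in> G i" "h \<in> G j"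
  shows "g * h = h * g"
proof -
  have "acts_only_on_pair N i g" "acts_only_on_pair N j h"
    using family assms by (auto simp: gate_family_def)
  moreover have "i < N" "j < N"
    using assms(2,3) by auto
  ultimately show ?thesis
    using assms(1-3) disjoint_gates_commute [of N i g j h] disjoint_gates_commute [of N j h i g]
    by (auto simp: disjoint_spins_def)
qed

lemma circuit_op_carrier [intro]:
  "is_circuit N G c \<Longrightarrow> circuit_op N c \<in> carrier_mat (2 ^ N) (2 ^ N)"
proof (induction c)
  case (Cons p c)
  then show ?case
    using mult_carrier_mat [OF _ gate_carrier, of "circuit_op N c" "2 ^ N" "fst p" "snd p"]
    by (cases p) simp
qed simp

lemma circuit_op_append:
  "is_circuit N G c \<Longrightarrow> is_circuit N G d \<Longrightarrow> circuit_op N (c @ d) = circuit_op N d * circuit_op N c"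
proof (induction c)
  case Nil
  then show ?case
    using circuit_op_carrier [of d] by simp
next
  case (Cons p c)
  then show ?case
    by (cases p)
      (auto simp: assoc_mult_mat [OF circuit_op_carrier circuit_op_carrier gate_carrier])
qed

lemma circuit_op_context:
  assumes "is_circuit N G (xs @ c @ ys)" "is_circuit N G d" "circuit_op N c = circuit_op N d"
  shows "circuit_op N (xs @ c @ ys) = circuit_op N (xs @ d @ ys)"
  using assms by (simp add: circuit_op_append)

lemma circuit_op_1: "is_circuit N G [(i, g)] \<Longrightarrow> circuit_op N [(i, g)] = g"
  using gate_carrier [of i g] by simp

lemma circuit_op_2: "is_circuit N G [(i, g), (j, h)] \<Longrightarrow> circuit_op N [(i, g), (j, h)] = h * g"
  using gate_carrier [of j h] by simp

lemma circuit_op_3: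
  "is_circuit N G [(i, g), (j, h), (k, l)] \<Longrightarrow>
    circuit_op N [(i, g), (j, h), (k, l)] = l * h * g"
  using gate_carrier [of k l] by simp

lemma reorder_step_sound:
  assumes "reorder_step c d" "is_circuit N G c"
  shows "is_circuit N G d \<and> circuit_op N d = circuit_op N c"
  using assms
proof cases
  case (1 i j xs g h ys)
  then have "circuit_op N [(i, g), (j, h)] = circuit_op N [(j, h), (i, g)]"
    using assms(2) gates_commute [of i j g h] by (simp add: circuit_op_2 del: circuit_op.simps)
  with 1 assms(2) show ?thesis
    using circuit_op_context [of xs "[(i, g), (j, h)]" ys "[(j, h), (i, g)]"] by simp
qed

lemma turnover_step_sound:
  assumes "turnover_step G c d" "is_circuit N G c"
  shows "is_circuit N G d \<and> circuit_op N d = circuit_op N c"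
  using assms
proof cases
  case (up g1 i g2 g3 ga gb gc xs ys)
  let ?c = "[(i, g1), (i + 1, g2), (i, g3)]" and ?d = "[(i + 1, ga), (i, gb), (i + 1, gc)]"
  have "is_circuit N G ?c" and d: "is_circuit N G ?d"
    using up assms(2) by auto
  then have "circuit_op N ?c = circuit_op N ?d"
    using up by (simp add: circuit_op_3 del: circuit_op.simps)
  with up assms(2) d show ?thesis
    using circuit_op_context [of xs ?c ys ?d] by simp
next
  case (down ga i gb gc g1 g2 g3 xs ys)
  let ?c = "[(i + 1, ga), (i, gb), (i + 1, gc)]" and ?d = "[(i, g1), (i + 1, g2), (i, g3)]"
  have "is_circuit N G ?c" and d: "is_circuit N G ?d"
    using down assms(2) by auto
  then have "circuit_op N ?c = circuit_op N ?d"
    using down by (simp add: circuit_op_3 del: circuit_op.simps)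
  with down assms(2) d show ?thesis
    using circuit_op_context [of xs ?c ys ?d] by simp
qed

lemma fusion_step_sound:
  assumes "fusion_step c d" "is_circuit N G c"
  shows "is_circuit N G d \<and> circuit_op N d = circuit_op N c"
  using assms
proof cases
  case (1 xs i g h ys)
  have gh: "is_circuit N G [(i, g), (i, h)]" and hg: "is_circuit N G [(i, h * g)]"
    using 1 assms(2) fusion by (auto simp: allows_fusion_def)
  then have "circuit_op N [(i, g), (i, h)] = circuit_op N [(i, h * g)]"
    by (simp only: circuit_op_1 circuit_op_2)
  with 1 assms(2) hg show ?thesis
    using circuit_op_context [of xs "[(i, g), (i, h)]" ys "[(i, h * g)]"] by simp
qed

lemma converts_sound:
  "converts G a b c d \<Longrightarrow> is_circuit N G c \<Longrightarrow>
    is_circuit N G d \<and> circuit_op N d = circuit_op N c"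
  by (induction rule: converts.induct)
    (auto dest: reorder_step_sound turnover_step_sound fusion_step_sound)

text \<open>
  Which turnovers and fusions are possible depends on the positions alone, so the combinatorics takes
  place on words of positions. Turnovers are counted up to an upper bound, fusions exactly.
\<close>

definition reduces :: "nat \<Rightarrow> nat \<Rightarrow> nat list \<Rightarrow> nat list \<Rightarrow> bool" where
  "reduces a b w w' \<longleftrightarrow> (\<forall>c. is_circuit N G c \<and> map fst c = w \<longrightarrow>
     (\<exists>c' a'. map fst c' = w' \<and> a' \<le> a \<and> converts G a' b c c'))"

definition braids :: "nat \<Rightarrow> nat list \<Rightarrow> nat list \<Rightarrow> bool" where
  "braids a w w' \<longleftrightarrow> reduces a 0 w w' \<and> reduces a 0 w' w"

lemma reducesE:
  assumes "reduces a b w w'" "is_circuit N G c" "map fst c = w"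
  obtains c' a' where "is_circuit N G c'" "map fst c' = w'" "circuit_op N c' = circuit_op N c"
    "a' \<le> a" "converts G a' b c c'"
  using assms converts_sound unfolding reduces_def by metis

lemma reduces_trans [trans]:
  assumes "reduces a b u v" "reduces a' b' v w"
  shows "reduces (a + a') (b + b') u w"
  unfolding reduces_def
proof (intro allI impI, elim conjE)
  fix c
  assume c: "is_circuit N G c" "map fst c = u"
  obtain d k where d: "is_circuit N G d" "map fst d = v" "k \<le> a" "converts G k b c d"
    using reducesE [OF assms(1) c] by metis
  obtain e l where e: "map fst e = w" "l \<le> a'" "converts G l b' d e"
    using reducesE [OF assms(2) d(1,2)] by metis
  from d e show "\<exists>c' a''. map fst c' = w \<and> a'' \<le> a + a' \<and> converts G a'' (b + b') c c'"
    by (intro exI [of _ e] exI [of _ "k + l"]) (auto intro: converts_trans)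
qed

lemma reduces_mono: "reduces a b u v \<Longrightarrow> a \<le> a' \<Longrightarrow> reduces a' b u v"
  unfolding reduces_def
proof (intro allI impI)
  fix c
  assume "\<forall>c. is_circuit N G c \<and> map fst c = u \<longrightarrow>
      (\<exists>c' k. map fst c' = v \<and> k \<le> a \<and> converts G k b c c')"
    and "a \<le> a'" and "is_circuit N G c \<and> map fst c = u"
  then obtain c' k where "map fst c' = v" "k \<le> a'" "converts G k b c c'"
    using le_trans by blast
  then show "\<exists>c' k. map fst c' = v \<and> k \<le> a' \<and> converts G k b c c'"
    by blast
qed

lemma reduces_refl: "reduces a 0 w w"
  unfolding reduces_def using converts.refl by blast

lemma reduces_context:
  assumes "reduces a b u v"
  shows "reduces a b (xs @ u @ ys) (xs @ v @ ys)"
  unfolding reduces_def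
proof (intro allI impI, elim conjE)
  fix c
  assume c: "is_circuit N G c" "map fst c = xs @ u @ ys"
  obtain c1 d where d: "c = c1 @ d" "map fst c1 = xs" "map fst d = u @ ys"
    using c(2) unfolding map_eq_append_conv [of fst c] by metis
  obtain c2 c3 where "d = c2 @ c3" "map fst c2 = u" "map fst c3 = ys"
    using d(3) unfolding map_eq_append_conv by metis
  with d have c': "c = c1 @ c2 @ c3" "map fst c1 = xs" "map fst c2 = u" "map fst c3 = ys"
    by simp_all
  have "is_circuit N G c2"
    using c(1) c'(1) by simp
  with c'(3) obtain d k where "map fst d = v" "k \<le> a" "converts G k b c2 d"
    using reducesE [OF assms] by metis
  with c' show "\<exists>c' a'. map fst c' = xs @ v @ ys \<and> a' \<le> a \<and> converts G a' b c c'"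
    by (intro exI [of _ "c1 @ d @ c3"] exI [of _ k]) (auto intro: converts_context)
qed

lemma braids_refl: "braids a w w"
  by (simp add: braids_def reduces_refl)

lemma braids_sym: "braids a u v \<Longrightarrow> braids a v u"
  by (simp add: braids_def)

lemma braids_mono: "braids a u v \<Longrightarrow> a \<le> a' \<Longrightarrow> braids a' u v"
  unfolding braids_def using reduces_mono by blast

lemma braids_trans [trans]: "braids a u v \<Longrightarrow> braids a' v w \<Longrightarrow> braids (a + a') u w"
  unfolding braids_def using reduces_trans [of a 0 u v a' 0 w] reduces_trans [of a' 0 w v a 0 u]
  by (simp add: add.commute)

lemma braids_reduces_trans [trans]: "braids a u v \<Longrightarrow> reduces a' b v w \<Longrightarrow> reduces (a + a') b u w"
  unfolding braids_def using reduces_trans [of a 0 u v a' b w] by simp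

lemma reduces_braids_trans [trans]: "reduces a b u v \<Longrightarrow> braids a' v w \<Longrightarrow> reduces (a + a') b u w"
  unfolding braids_def using reduces_trans [of a b u v a' 0 w] by simp

lemma braids_context: "braids a u v \<Longrightarrow> braids a (xs @ u @ ys) (xs @ v @ ys)"
  by (simp add: braids_def reduces_context)

lemma reduces_swap:
  assumes "disjoint_spins i j"
  shows "reduces 0 0 [i, j] [j, i]"
  unfolding reduces_def
proof (intro allI impI, elim conjE)
  fix c :: circuit
  assume "map fst c = [i, j]"
  then obtain g h where "c = [(i, g), (j, h)]"
    by (auto simp: map_eq_Cons_conv)
  moreover have "converts G 0 0 [(i, g), (j, h)] [(j, h), (i, g)]"
    using reorder_step.intros [OF assms, of "[]" g h "[]"]
    by (auto intro: converts.intros)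
  ultimately show "\<exists>c' a'. map fst c' = [j, i] \<and> a' \<le> 0 \<and> converts G a' 0 c c'"
    by (intro exI [of _ "[(j, h), (i, g)]"]) auto
qed

lemma braids_swap: "disjoint_spins i j \<Longrightarrow> braids 0 [i, j] [j, i]"
  using reduces_swap [of i j] reduces_swap [of j i]
  by (auto simp: braids_def disjoint_spins_def)

lemma turnoverE:
  assumes "is_circuit N G [(i, g1), (i + 1, g2), (i, g3)]"
  obtains ga gb gc where "ga \<in> G (i + 1)" "gb \<in> G i" "gc \<in> G (i + 1)"
    "g3 * g2 * g1 = gc * gb * ga"
proof -
  have "i \<in> {1..N - 2}" "g1 \<in> G i" "g2 \<in> G (i + 1)" "g3 \<in> G i"
    using assms by auto
  with turnover show ?thesis
    unfolding allows_turnover_def using that by metis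
qed

lemma turnoverE':
  assumes "is_circuit N G [(i + 1, ga), (i, gb), (i + 1, gc)]"
  obtains g1 g2 g3 where "g1 \<in> G i" "g2 \<in> G (i + 1)" "g3 \<in> G i"
    "gc * gb * ga = g3 * g2 * g1"
proof -
  have "i \<in> {1..N - 2}" "ga \<in> G (i + 1)" "gb \<in> G i" "gc \<in> G (i + 1)"
    using assms by auto
  with turnover show ?thesis
    unfolding allows_turnover_def using that by metis
qed

lemma braids_turnover: "braids 1 [i, Suc i, i] [Suc i, i, Suc i]"
proof -
  have "reduces 1 0 [i, i + 1, i] [i + 1, i, i + 1]"
    unfolding reduces_def
  proof (intro allI impI, elim conjE)
    fix c
    assume c: "is_circuit N G c" "map fst c = [i, i + 1, i]"
    then obtain g1 g2 g3 where cg: "c = [(i, g1), (i + 1, g2), (i, g3)]"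
      by (auto simp: map_eq_Cons_conv)
    with c obtain ga gb gc where g: "ga \<in> G (i + 1)" "gb \<in> G i" "gc \<in> G (i + 1)"
        "g3 * g2 * g1 = gc * gb * ga"
      using turnoverE by metis
    let ?d = "[(i + 1, ga), (i, gb), (i + 1, gc)]"
    have "turnover_step G c ?d"
      using turnover_step.up [of g1 G i g2 g3 ga gb gc "[]" "[]"] c g by (simp add: cg)
    then have "converts G 1 0 c ?d"
      using converts.turnover [OF converts.refl] by simp
    then show "\<exists>c' a'. map fst c' = [i + 1, i, i + 1] \<and> a' \<le> 1 \<and> converts G a' 0 c c'"
      by (intro exI [of _ ?d] exI [of _ 1]) simp
  qed
  moreover have "reduces 1 0 [i + 1, i, i + 1] [i, i + 1, i]"
    unfolding reduces_def
  proof (intro allI impI, elim conjE)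
    fix c
    assume c: "is_circuit N G c" "map fst c = [i + 1, i, i + 1]"
    then obtain ga gb gc where cg: "c = [(i + 1, ga), (i, gb), (i + 1, gc)]"
      by (auto simp: map_eq_Cons_conv)
    with c obtain g1 g2 g3 where g: "g1 \<in> G i" "g2 \<in> G (i + 1)" "g3 \<in> G i"
        "gc * gb * ga = g3 * g2 * g1"
      using turnoverE' by metis
    let ?d = "[(i, g1), (i + 1, g2), (i, g3)]"
    have "turnover_step G c ?d"
      using turnover_step.down [of ga G i gb gc g1 g2 g3 "[]" "[]"] c g by (simp add: cg)
    then have "converts G 1 0 c ?d"
      using converts.turnover [OF converts.refl] by simp
    then show "\<exists>c' a'. map fst c' = [i, i + 1, i] \<and> a' \<le> 1 \<and> converts G a' 0 c c'"
      by (intro exI [of _ ?d] exI [of _ 1]) simp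
  qed
  ultimately show ?thesis
    by (simp add: braids_def)
qed

lemma reduces_fusion: "reduces 0 1 [i, i] [i]"
  unfolding reduces_def
proof (intro allI impI, elim conjE)
  fix c :: circuit
  assume "map fst c = [i, i]"
  then obtain g h where c: "c = [(i, g), (i, h)]"
    by (auto simp: map_eq_Cons_conv)
  have "fusion_step c [(i, h * g)]"
    using fusion_step.intros [of "[]" i g h "[]"] by (simp add: c)
  then have "converts G 0 1 c [(i, h * g)]"
    using converts.fusion [OF converts.refl] by simp
  then show "\<exists>c' a'. map fst c' = [i] \<and> a' \<le> 0 \<and> converts G a' 1 c c'"
    by (intro exI [of _ "[(i, h * g)]"] exI [of _ 0]) simp
qed

lemma braids_commute1:
  "\<forall>j\<in>set v. disjoint_spins i j \<Longrightarrow> braids 0 (i # v) (v @ [i])"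
proof (induction v)
  case (Cons j v)
  have "braids 0 ([] @ [i, j] @ v) ([] @ [j, i] @ v)"
    using Cons.prems by (intro braids_context braids_swap) simp
  moreover have "braids 0 ([j] @ (i # v) @ []) ([j] @ (v @ [i]) @ [])"
    using Cons by (intro braids_context) auto
  ultimately show ?case
    using braids_trans [of 0 "i # j # v" "j # i # v" 0 "j # v @ [i]"] by simp
qed (simp add: braids_refl)

lemma braids_commute:
  "\<forall>i\<in>set u. \<forall>j\<in>set v. disjoint_spins i j \<Longrightarrow> braids 0 (u @ v) (v @ u)"
proof (induction u)
  case (Cons i u)
  have "braids 0 ([i] @ (u @ v) @ []) ([i] @ (v @ u) @ [])"
    using Cons by (intro braids_context) auto
  moreover have "braids 0 ([] @ (i # v) @ u) ([] @ (v @ [i]) @ u)"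
    using Cons.prems by (intro braids_context braids_commute1) simp
  ultimately show ?case
    using braids_trans [of 0 "i # u @ v" "i # v @ u" 0 "v @ i # u"] by simp
qed (simp add: braids_refl)

lemma braids_permute:
  assumes "mset w = mset w'" "distinct w"
    "\<And>i j. i \<in> set w \<Longrightarrow> j \<in> set w \<Longrightarrow> i \<noteq> j \<Longrightarrow> disjoint_spins i j"
  shows "braids 0 w w'"
  using assms
proof (induction w' arbitrary: w)
  case (Cons x w')
  then have "x \<in> set w"
    by (metis list.set_intros(1) set_mset_mset)
  then obtain u v where w: "w = u @ x # v"
    by (meson split_list)
  have "braids 0 ([] @ (u @ [x]) @ v) ([] @ ([x] @ u) @ v)"
    using Cons.prems(2,3) by (intro braids_context braids_commute) (auto simp: w)
  moreover have "braids 0 ([x] @ (u @ v) @ []) ([x] @ w' @ [])"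
    using Cons.prems by (intro braids_context Cons.IH) (auto simp: w)
  ultimately show ?case
    using braids_trans [of 0 w "x # u @ v" 0 "x # w'"] by (simp add: w)
qed (simp add: braids_refl)

section \<open>Triangles\<close>

lemma braids_cascade_pass:
  assumes "m \<le> i" "i + 1 < c"
  shows "braids 1 ([m..<c] @ [i]) (Suc i # [m..<c])"
proof -
  have "[m..<c] = [m..<i] @ [i..<c]"
    using assms upt_add_eq_append [of m i "c - i"] by simp
  also have "[i..<c] = [i, Suc i] @ [i + 2..<c]"
    using assms by (simp add: upt_conv_Cons)
  finally have c: "[m..<c] = [m..<i] @ [i, Suc i] @ [i + 2..<c]" .
  have "braids 0 (([m..<i] @ [i, Suc i]) @ ([i + 2..<c] @ [i]) @ [])
      (([m..<i] @ [i, Suc i]) @ ([i] @ [i + 2..<c]) @ [])"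
    by (intro braids_context braids_commute) (auto simp: disjoint_spins_def)
  also have "braids 1 \<dots> ([m..<i] @ [Suc i, i, Suc i] @ [i + 2..<c])"
    using braids_context [OF braids_turnover, of "[m..<i]" i "[i + 2..<c]"] by simp
  also have "braids 0 \<dots> ([] @ ([Suc i] @ [m..<i]) @ [i, Suc i] @ [i + 2..<c])"
    using braids_context [OF braids_commute [of "[m..<i]" "[Suc i]"], of "[]" "[i, Suc i] @ [i + 2..<c]"]
    by (simp add: disjoint_spins_def)
  finally show ?thesis
    by (simp add: c)
qed

lemma braids_cascade_pass_word:
  "\<forall>i\<in>set v. m \<le> i \<and> i + 1 < c \<Longrightarrow> braids (length v) ([m..<c] @ v) (map Suc v @ [m..<c])"
proof (induction v)
  case (Cons i v)
  have "braids 1 ([] @ ([m..<c] @ [i]) @ v) ([] @ (Suc i # [m..<c]) @ v)"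
    using Cons.prems by (intro braids_context braids_cascade_pass) auto
  moreover have "braids (length v) ([Suc i] @ ([m..<c] @ v) @ []) ([Suc i] @ (map Suc v @ [m..<c]) @ [])"
    using Cons by (intro braids_context) auto
  ultimately show ?case
    using braids_trans [of 1 "[m..<c] @ i # v" "Suc i # [m..<c] @ v" "length v"] by simp
qed (simp add: braids_refl)

definition cascades :: "nat \<Rightarrow> nat list" where
  "cascades m = concat (map (\<lambda>j. [j..<N]) (rev [m..<N]))"

lemma cascades_rec: "m < N \<Longrightarrow> cascades m = cascades (Suc m) @ [m..<N]"
  by (simp add: cascades_def upt_conv_Cons)

lemma cascades_empty [simp]: "N \<le> m \<Longrightarrow> cascades m = []"
  by (simp add: cascades_def)

lemma set_cascades: "set (cascades m) \<subseteq> {m..<N}"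
  by (auto simp: cascades_def)

lemma triangle_circuit_iff:
  "triangle_circuit N G t \<longleftrightarrow> is_circuit N G t \<and> map fst t = cascades 1"
proof -
  have rev: "rev [1..<N] = map (\<lambda>k. N - k) [1..<N]"
    by (rule nth_equalityI) (auto simp: rev_nth)
  have "map (\<lambda>k. [N - k..<N]) [1..<N] = map (\<lambda>j. [j..<N]) (rev [1..<N])"
    unfolding rev by (simp add: comp_def)
  then show ?thesis
    by (simp add: triangle_circuit_def cascades_def)
qed

lemma length_triangle:
  assumes "triangle_circuit N G t"
  shows "length t = N * (N - 1) div 2"
proof -
  have "length t = length (concat (map (\<lambda>k. [N - k..<N]) [1..<N]))"
    using assms unfolding triangle_circuit_def by (simp flip: length_map [of fst])
  also have "\<dots> = (\<Sum>k\<leftarrow>[1..<N]. N - (N - k))"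
    by (simp add: length_concat comp_def)
  also have "\<dots> = (\<Sum>k = 1..<N. N - (N - k))"
    by (simp add: interv_sum_list_conv_sum_set_nat)
  also have "\<dots> = (\<Sum>k = 1..<N. k)"
    by (rule sum.cong) auto
  also have "\<dots> = \<Sum>{0..N - 1}"
    using two_le by (intro sum.mono_neutral_left) auto
  also have "\<dots> = N * (N - 1) div 2"
    using two_le by (simp add: gauss_sum_nat mult.commute)
  finally show ?thesis .
qed

lemma cascades_insert_right:
  assumes "m \<le> i" "i < N"
  shows "reduces (N - 1 - i) 1 (cascades m @ [i]) (cascades m)"
  using assms
proof (induction "N - 1 - i" arbitrary: m i)
  case 0
  then have N: "N = Suc i" by simp
  with 0 have "[m..<N] = [m..<i] @ [i]" by simp
  with 0 have "cascades m = (cascades (Suc m) @ [m..<i]) @ [i]"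
    by (simp add: cascades_rec [of m])
  then show ?case
    using reduces_context [OF reduces_fusion, of "cascades (Suc m) @ [m..<i]" i "[]"]
    by (auto intro: reduces_mono)
next
  case (Suc k)
  then have i: "Suc i < N" and m: "m < N" by auto
  have "braids 1 (cascades (Suc m) @ ([m..<N] @ [i]) @ []) (cascades (Suc m) @ (Suc i # [m..<N]) @ [])"
    using Suc.prems i by (intro braids_context braids_cascade_pass) auto
  also have "reduces (N - 1 - Suc i) 1 \<dots> (cascades (Suc m) @ [m..<N])"
    using Suc i
      reduces_context [of "N - 1 - Suc i" 1 "cascades (Suc m) @ [Suc i]" "cascades (Suc m)" "[]" "[m..<N]"]
    by simp
  finally show ?case
    using i m by (simp add: cascades_rec [of m] Suc_diff_Suc)
qed

text \<open>
  The letter \<open>i\<close> turns the cascade from \<open>i + 1\<close> into a second cascade from \<open>i\<close>. Since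
  a cascade from \<open>i\<close> carries \<open>[i..<N - 1]\<close> to \<open>[i + 1..<N]\<close>, the two equal cascades
  can be interlocked so that their leading letters meet and fuse, and then be released again.
\<close>

lemma cascades_insert_left_start:
  assumes "i < N"
  shows "reduces (2 * (N - 1 - i)) 1 (i # cascades i) (cascades i)"
proof (cases "Suc i < N")
  case False
  with assms have "[i..<N] = [i]" by (simp add: upt_conv_Cons)
  with False assms have "cascades i = [i]"
    by (simp add: cascades_rec [of i])
  with reduces_fusion [of i] show ?thesis
    by (auto intro: reduces_mono)
next
  case True
  let ?c = "cascades (Suc (Suc i))"
  have c: "cascades i = ?c @ [Suc i..<N] @ [i..<N]"
    using True by (simp add: cascades_rec)
  have iN: "[i..<N] = i # [Suc i..<N]"
    using assms by (simp add: upt_conv_Cons)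
  have pass: "braids (N - 1 - i) ([i..<N] @ [i..<N - 1]) ([Suc i..<N] @ [i..<N])"
    using braids_cascade_pass_word [of "[i..<N - 1]" i N] True by (fastforce simp: map_Suc_upt)
  have "braids 0 (i # cascades i) (?c @ [i] @ [Suc i..<N] @ [i..<N])"
    using braids_context [OF braids_commute1 [of ?c i], of "[]" "[Suc i..<N] @ [i..<N]"]
      set_cascades [of "Suc (Suc i)"] by (force simp: c disjoint_spins_def)
  also have "braids (N - 1 - i) \<dots> (?c @ [i] @ [i..<N] @ [i..<N - 1])"
    using braids_context [OF braids_sym [OF pass], of "?c @ [i]" "[]"] by simp
  also have "reduces 0 1 \<dots> (?c @ [i..<N] @ [i..<N - 1])"
    using reduces_context [OF reduces_fusion, of ?c i "[Suc i..<N] @ [i..<N - 1]"] by (simp add: iN)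
  also have "braids (N - 1 - i) \<dots> (?c @ [Suc i..<N] @ [i..<N])"
    using braids_context [OF pass, of ?c "[]"] by simp
  finally show ?thesis
    by (simp add: c mult_2)
qed

lemma cascades_insert_left:
  assumes "m \<le> i" "i < N"
  shows "reduces (2 * (N - 1 - i)) 1 (i # cascades m) (cascades m)"
  using assms
proof (induction rule: inc_induct)
  case base
  then show ?case by (rule cascades_insert_left_start)
next
  case (step m)
  then show ?case
    using reduces_context [of "2 * (N - 1 - i)" 1 "i # cascades (Suc m)" "cascades (Suc m)" "[]" "[m..<N]"]
    by (simp add: cascades_rec [of m])
qed

lemma cascades_absorb_right:
  "set w \<subseteq> {1..N - 1} \<Longrightarrow> reduces (2 * N * length w) (length w) (cascades 1 @ w) (cascades 1)"
proof (induction w)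
  case (Cons i w)
  have "reduces (2 * N) 1 (cascades 1 @ [i]) (cascades 1)"
    using Cons.prems by (intro reduces_mono [OF cascades_insert_right]) auto
  from reduces_context [OF this, of "[]" w]
  have "reduces (2 * N) 1 (cascades 1 @ i # w) (cascades 1 @ w)"
    by simp
  from reduces_trans [OF this Cons.IH] Cons.prems show ?case
    by simp
qed (simp add: reduces_refl)

lemma cascades_absorb_left:
  "set w \<subseteq> {1..N - 1} \<Longrightarrow> reduces (2 * N * length w) (length w) (w @ cascades 1) (cascades 1)"
proof (induction w)
  case (Cons i w)
  have "reduces (2 * N) 1 (i # cascades 1) (cascades 1)"
    using Cons.prems by (intro reduces_mono [OF cascades_insert_left]) auto
  moreover have "reduces (2 * N * length w) (length w) ([i] @ (w @ cascades 1) @ []) ([i] @ cascades 1 @ [])"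
    using Cons by (intro reduces_context) simp
  ultimately have "reduces (2 * N * length w + 2 * N) (length w + 1) ([i] @ (w @ cascades 1) @ []) (cascades 1)"
    by (intro reduces_trans) auto
  then show ?case
    by (simp add: add.commute)
qed (simp add: reduces_refl)

section \<open>Squares\<close>

definition positions :: "nat \<Rightarrow> nat \<Rightarrow> nat \<Rightarrow> nat list" where
  "positions j m n = filter (\<lambda>i. even i = even j) [m..<n]"

lemma positions_split: "m \<le> c \<Longrightarrow> c \<le> n \<Longrightarrow> positions j m n = positions j m c @ positions j c n"
  unfolding positions_def filter_append [symmetric]
  using upt_add_eq_append [of m c "n - c"] by simp

lemma positions_empty [simp]: "n \<le> m \<Longrightarrow> positions j m n = []"
  by (simp add: positions_def)

lemma positions_Cons:
  "m < n \<Longrightarrow> positions j m n = (if even m = even j then [m] else []) @ positions j (Suc m) n"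
  by (simp add: positions_def upt_conv_Cons)

lemma positions_cong: "even j = even k \<Longrightarrow> positions j m n = positions k m n"
  by (simp add: positions_def)

lemma map_Suc_positions: "map Suc (positions j m n) = positions (Suc j) (Suc m) (Suc n)"
  unfolding positions_def map_Suc_upt [symmetric] filter_map by (simp add: comp_def)

lemma set_positions: "set (positions j m n) = {i \<in> {m..<n}. even i = even j}"
  by (auto simp: positions_def)

lemma distinct_positions: "distinct (positions j m n)"
  by (simp add: positions_def)

lemma length_positions_le: "length (positions j m n) \<le> n - m"
  unfolding positions_def using length_filter_le [of _ "[m..<n]"] by simp

definition layers :: "nat \<Rightarrow> nat \<Rightarrow> nat list" where
  "layers m n = concat (map (\<lambda>k. positions (Suc k) m N) [0..<n])"

lemma layers_0 [simp]: "layers m 0 = []"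
  by (simp add: layers_def)

lemma layers_Suc: "layers m (Suc n) = layers m n @ positions (Suc n) m N"
  by (simp add: layers_def)

text \<open>
  The cascade grows by one letter per layer. The letters of the new layer left of it pass through it
  and are shifted by one, which completes the previous layer of the smaller square.
\<close>

lemma braids_cascade_layer:
  assumes "m \<le> c" "c \<le> N"
  shows "braids N ([m..<c] @ positions (Suc c) (Suc c) N @ positions c m N)
    (positions (Suc c) (Suc m) N @ [m..<min (Suc c) N] @ positions c (c + 2) N)"
proof -
  let ?X = "positions (Suc c) (Suc c) N" and ?low = "positions c m c"
    and ?rest = "positions c c N"
  have low: "m \<le> i \<and> i + 1 < c" if "i \<in> set ?low" for i
  proof -
    have i: "m \<le> i" "i < c" "even i = even c"
      using that by (auto simp: set_positions)
    then have "Suc i \<noteq> c" by auto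
    with i show ?thesis by simp
  qed
  have "positions c m N = ?low @ ?rest"
    using assms by (rule positions_split)
  then have "braids 0 ([m..<c] @ ?X @ positions c m N) ([m..<c] @ (?low @ ?X) @ ?rest)"
    using braids_context [OF braids_commute [of ?X ?low], of "[m..<c]" ?rest]
    by (auto simp: set_positions disjoint_spins_def)
  also have "braids (length ?low) \<dots> ((map Suc ?low @ [m..<c]) @ ?X @ ?rest)"
    using braids_context [OF braids_cascade_pass_word [of ?low m c], of "[]" "?X @ ?rest"] low
    by simp
  also have "braids 0 \<dots> (map Suc ?low @ (?X @ [m..<c]) @ ?rest)"
    using braids_context [OF braids_commute [of "[m..<c]" ?X], of "map Suc ?low" ?rest]
    by (auto simp: set_positions disjoint_spins_def)
  also have "map Suc ?low @ (?X @ [m..<c]) @ ?rest =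
      positions (Suc c) (Suc m) N @ [m..<min (Suc c) N] @ positions c (c + 2) N"
  proof (cases "c < N")
    case True
    then have "positions (Suc c) (Suc m) N = map Suc ?low @ ?X"
      using assms by (simp add: map_Suc_positions positions_split [of "Suc m" "Suc c" N])
    moreover have "positions c (Suc c) N = positions c (Suc (Suc c)) N"
      by (cases "Suc c < N") (simp_all add: positions_Cons)
    ultimately show ?thesis
      using True assms by (simp add: positions_Cons [of c N])
  next
    case False
    with assms have c: "c = N" by simp
    have "map Suc ?low = positions (Suc c) (Suc m) N"
    proof (cases "m = N")
      case False
      then have "Suc m \<le> N" using assms by simp
      then show ?thesis
        using positions_split [of "Suc m" N "Suc N" "Suc N"] positions_Cons [of N "Suc N" "Suc N"]
        by (simp add: map_Suc_positions c)
    qed (simp add: c)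
    then show ?thesis
      by (simp add: c)
  qed
  finally have "braids (length ?low) ([m..<c] @ ?X @ positions c m N)
      (positions (Suc c) (Suc m) N @ [m..<min (Suc c) N] @ positions c (c + 2) N)"
    by simp
  moreover have "length ?low \<le> N"
    using length_positions_le [of c m c] assms by simp
  ultimately show ?thesis
    by (rule braids_mono)
qed

lemma braids_peel_layers:
  assumes "m \<le> c0" "c0 \<le> Suc m" "c0 \<le> N" "even c0" "c0 + k \<le> Suc N"
  shows "braids (k * N) (layers m (Suc k))
    (layers (Suc m) k @ [m..<min (c0 + k) N] @ positions (Suc k) (Suc (c0 + k)) N)"
  using assms
proof (induction k)
  case 0
  have "layers m (Suc 0) = [m..<min c0 N] @ positions 1 (Suc c0) N"
  proof (cases "c0 = m")
    case True
    then show ?thesis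
      using 0 by (cases "m < N") (simp_all add: layers_Suc positions_Cons)
  next
    case False
    then have c0: "c0 = Suc m" using 0 by simp
    moreover have "positions 1 (Suc m) N = positions 1 (Suc (Suc m)) N"
      using c0 0 by (cases "Suc m < N") (simp_all add: positions_Cons)
    ultimately show ?thesis
      using 0 by (simp add: layers_Suc positions_Cons)
  qed
  then show ?case
    by (simp add: braids_refl)
next
  case (Suc k)
  let ?c = "c0 + k"
  have c: "?c \<le> N" "m \<le> ?c"
    using Suc.prems by auto
  have p: "positions (Suc k) a b = positions (Suc ?c) a b"
    "positions (Suc (Suc k)) a b = positions ?c a b" for a b
    using Suc.prems(4) by (auto intro: positions_cong)
  have "braids (k * N) (layers m (Suc k))
      (layers (Suc m) k @ [m..<?c] @ positions (Suc ?c) (Suc ?c) N)"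
    using Suc c by (simp add: p min_def)
  from braids_context [OF this, of "[]" "positions ?c m N"]
  have "braids (k * N) (layers m (Suc (Suc k)))
      (layers (Suc m) k @ [m..<?c] @ positions (Suc ?c) (Suc ?c) N @ positions ?c m N)"
    by (simp add: layers_Suc [of m "Suc k"] p)
  also have "braids N \<dots> (layers (Suc m) k @
      positions (Suc ?c) (Suc m) N @ [m..<min (Suc ?c) N] @ positions ?c (?c + 2) N)"
    using braids_context [OF braids_cascade_layer [OF c(2,1)], of "layers (Suc m) k" "[]"] by simp
  finally show ?case
    by (simp add: layers_Suc [of "Suc m" k] p add.commute)
qed

lemma braids_peel_square:
  assumes "m < N"
  shows "braids (N * N) (layers m (Suc (N - m))) (layers (Suc m) (N - m) @ [m..<N])"
proof -
  define c0 where "c0 = (if even m then m else Suc m)"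
  have "braids ((N - m) * N) (layers m (Suc (N - m)))
      (layers (Suc m) (N - m) @ [m..<min (c0 + (N - m)) N] @
        positions (Suc (N - m)) (Suc (c0 + (N - m))) N)"
    using assms by (intro braids_peel_layers) (auto simp: c0_def)
  moreover have "min (c0 + (N - m)) N = N" "N \<le> Suc (c0 + (N - m))"
    using assms by (auto simp: c0_def)
  ultimately have "braids ((N - m) * N) (layers m (Suc (N - m))) (layers (Suc m) (N - m) @ [m..<N])"
    by simp
  then show ?thesis
    by (rule braids_mono) simp
qed

lemma braids_layers_cascades:
  "m \<le> N \<Longrightarrow> braids ((N - m) * (N * N)) (layers m (Suc (N - m))) (cascades m)"
proof (induction rule: inc_induct)
  case base
  then show ?case
    by (simp add: layers_Suc braids_refl)
next
  case (step m)
  have "braids (N * N) (layers m (Suc (N - m))) (layers (Suc m) (N - m) @ [m..<N])"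
    using step by (intro braids_peel_square)
  also have "braids ((N - Suc m) * (N * N)) \<dots> (cascades (Suc m) @ [m..<N])"
    using braids_context [OF step.IH, of "[]" "[m..<N]"] step.hyps by (simp add: Suc_diff_Suc)
  finally have "braids (Suc (N - Suc m) * (N * N)) (layers m (Suc (N - m))) (cascades m)"
    using step.hyps by (simp add: cascades_rec [of m])
  then show ?case
    using step.hyps by (simp only: Suc_diff_Suc)
qed

lemma braids_square_triangle: "braids (N ^ 3) (layers 1 N) (cascades 1)"
proof -
  have "braids ((N - 1) * (N * N)) (layers 1 N) (cascades 1)"
    using braids_layers_cascades [of 1] two_le by simp
  then show ?thesis
    by (rule braids_mono) (simp add: power3_eq_cube)
qed

lemma layer_iff:
  "(if even k then odd_layer N G l else even_layer N G l) \<longleftrightarrow>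
    is_circuit N G l \<and> distinct (map fst l) \<and> set (map fst l) = set (positions (Suc k) 1 N)"
proof -
  have "{1..N - 1} = {1..<N}"
    using two_le by auto
  then show ?thesis
    by (simp add: odd_layer_def even_layer_def set_positions)
qed

lemma disjoint_spins_positions:
  "i \<in> set (positions j m n) \<Longrightarrow> i' \<in> set (positions j m n) \<Longrightarrow> i \<noteq> i' \<Longrightarrow> disjoint_spins i i'"
proof -
  assume "i \<in> set (positions j m n)" "i' \<in> set (positions j m n)" "i \<noteq> i'"
  then have "Suc i \<noteq> i'" "Suc i' \<noteq> i" "i \<noteq> i'"
    by (auto simp: set_positions)
  then show ?thesis
    by (auto simp: disjoint_spins_def)
qed

lemma alternating_circuit_Suc:
  "alternating_circuit N G (Suc n) c \<longleftrightarrow> (\<exists>d l. c = d @ l \<and> alternating_circuit N G n d \<and>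
     (if even n then odd_layer N G l else even_layer N G l))"
proof -
  define L where "L k l = (if even k then odd_layer N G l else even_layer N G l)" for k :: nat and l
  have alt: "alternating_circuit N G k c \<longleftrightarrow> (\<exists>ls. length ls = k \<and> c = concat ls \<and> (\<forall>i<k. L i (ls ! i)))"
    for k c by (simp only: alternating_circuit_def L_def)
  have snoc: "(\<forall>i<Suc n. L i ((ls @ [l]) ! i)) \<longleftrightarrow> (\<forall>i<n. L i (ls ! i)) \<and> L n l"
    if "length ls = n" for ls l
    using that by (auto simp: nth_append All_less_Suc)
  have "alternating_circuit N G (Suc n) c \<longleftrightarrow>
      (\<exists>ls l. length ls = n \<and> c = concat ls @ l \<and> (\<forall>i<n. L i (ls ! i)) \<and> L n l)" (is "?L \<longleftrightarrow> ?R")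
  proof
    assume ?L
    then obtain ls where ls: "length ls = Suc n" "c = concat ls" "\<forall>i<Suc n. L i (ls ! i)"
      unfolding alt by blast
    then obtain ks l where "ls = ks @ [l]" "length ks = n"
      by (metis length_Suc_conv_rev)
    with ls show ?R
      using snoc [of ks l] by auto
  next
    assume ?R
    then obtain ls l where "length ls = n" "c = concat ls @ l" "\<forall>i<n. L i (ls ! i)" "L n l"
      by blast
    then show ?L
      unfolding alt using snoc [of ls l] by (intro exI [of _ "ls @ [l]"]) simp
  qed
  also have "\<dots> \<longleftrightarrow> (\<exists>d l. c = d @ l \<and> alternating_circuit N G n d \<and> L n l)"
    unfolding alt by blast
  finally show ?thesis
    by (simp only: L_def)
qed

lemma alternating_circuit_positions:
  "alternating_circuit N G n c \<Longrightarrow>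
    is_circuit N G c \<and> braids 0 (map fst c) (layers 1 n) \<and> length c \<le> n * N"
proof (induction n arbitrary: c)
  case 0
  then show ?case
    by (simp add: alternating_circuit_def braids_refl)
next
  case (Suc n)
  then obtain d l where c: "c = d @ l" "alternating_circuit N G n d"
      and "if even n then odd_layer N G l else even_layer N G l"
    unfolding alternating_circuit_Suc by blast
  then have l: "is_circuit N G l" "distinct (map fst l)"
      "set (map fst l) = set (positions (Suc n) 1 N)"
    unfolding layer_iff by auto
  have mset: "mset (map fst l) = mset (positions (Suc n) 1 N)"
    using l distinct_positions set_eq_iff_mset_eq_distinct by blast
  then have "braids 0 (map fst l) (positions (Suc n) 1 N)"
    using l disjoint_spins_positions [of _ "Suc n" 1 N] by (intro braids_permute) simp_all
  from braids_context [OF this, of "map fst d" "[]"]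
  have "braids 0 (map fst c) (map fst d @ positions (Suc n) 1 N)"
    by (simp add: c)
  also have "braids 0 \<dots> (layers 1 (Suc n))"
    using braids_context [of 0 "map fst d" "layers 1 n" "[]" "positions (Suc n) 1 N"] Suc.IH [OF c(2)]
    by (simp add: layers_Suc)
  finally have "braids 0 (map fst c) (layers 1 (Suc n))"
    by simp
  moreover have "length l \<le> N"
    using mset_eq_length [OF mset] length_positions_le [of "Suc n" 1 N] by simp
  ultimately show ?case
    using Suc.IH [OF c(2)] l by (simp add: c)
qed

lemma alternating_circuit_layers:
  assumes "is_circuit N G c" "map fst c = layers 1 n"
  shows "alternating_circuit N G n c"
  using assms
proof (induction n arbitrary: c)
  case 0
  then show ?case
    by (simp add: alternating_circuit_def)
next
  case (Suc n)
  then obtain d l where c: "c = d @ l" "map fst d = layers 1 n" "map fst l = positions (Suc n) 1 N"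
    by (auto simp: layers_Suc map_eq_append_conv)
  then have "if even n then odd_layer N G l else even_layer N G l"
    unfolding layer_iff using Suc.prems distinct_positions by auto
  moreover have "alternating_circuit N G n d"
    using c Suc by simp
  ultimately show ?case
    unfolding alternating_circuit_Suc using c(1) by blast
qed

lemma alternating_circuit_split:
  "alternating_circuit N G (n + k) c \<Longrightarrow>
    \<exists>d e. c = d @ e \<and> alternating_circuit N G n d \<and> is_circuit N G e \<and> length e \<le> k * N"
proof (induction k arbitrary: c)
  case 0
  then show ?case by (intro exI [of _ c] exI [of _ "[]"]) simp
next
  case (Suc k)
  then have "alternating_circuit N G (Suc (n + k)) c"
    by simp
  then obtain c' l where c: "c = c' @ l" "alternating_circuit N G (n + k) c'"
      and "if even (n + k) then odd_layer N G l else even_layer N G l"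
    unfolding alternating_circuit_Suc by blast
  then have l: "is_circuit N G l" "distinct (map fst l)"
      "set (map fst l) = set (positions (Suc (n + k)) 1 N)"
    unfolding layer_iff by auto
  then have mset: "mset (map fst l) = mset (positions (Suc (n + k)) 1 N)"
    using distinct_positions set_eq_iff_mset_eq_distinct by blast
  have "length l \<le> N"
    using mset_eq_length [OF mset] length_positions_le [of "Suc (n + k)" 1 N] by simp
  moreover obtain d e where "c' = d @ e" "alternating_circuit N G n d" "is_circuit N G e"
      "length e \<le> k * N"
    using Suc.IH [OF c(2)] by blast
  ultimately show ?case
    using c l by (intro exI [of _ d] exI [of _ "e @ l"]) simp
qed

section \<open>Converting and merging circuits\<close>

lemma square_circuit_arranged:
  assumes "square_circuit N G s"
  shows "arranged_in_depth N s"
proof -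
  obtain ls where ls: "length ls = N" "s = concat ls"
      "\<forall>k<N. if even k then odd_layer N G (ls ! k) else even_layer N G (ls ! k)"
    using assms unfolding square_circuit_def alternating_circuit_def by blast
  have sorted: "sorted_wrt disjoint_spins w" if "distinct w" "set w = set (positions j 1 N)" for w j
    unfolding sorted_wrt_iff_nth_less
  proof (intro allI impI)
    fix i i'
    assume i: "i < i'" "i' < length w"
    then have "w ! i \<in> set w" "w ! i' \<in> set w" "w ! i \<noteq> w ! i'"
      using nth_eq_iff_index_eq [OF that(1)] by auto
    then show "disjoint_spins (w ! i) (w ! i')"
      unfolding that(2) by (rule disjoint_spins_positions)
  qed
  have "sorted_wrt disjoint_spins (map fst (ls ! k))" if "k < N" for k
    using ls(3) that unfolding layer_iff by (intro sorted) blast+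
  then show ?thesis
    using ls unfolding arranged_in_depth_def by (metis in_set_conv_nth)
qed

lemma square_to_triangle:
  assumes "square_circuit N G s"
  obtains t a where "triangle_circuit N G t" "circuit_op N t = circuit_op N s"
    "converts G a 0 s t" "a \<le> N ^ 3"
proof -
  have s: "is_circuit N G s" "braids 0 (map fst s) (layers 1 N)"
    using assms alternating_circuit_positions unfolding square_circuit_def by blast+
  from braids_trans [OF s(2) braids_square_triangle]
  have "reduces (N ^ 3) 0 (map fst s) (cascades 1)"
    by (simp add: braids_def)
  from reducesE [OF this s(1) HOL.refl] that show thesis
    unfolding triangle_circuit_iff by metis
qed

lemma triangle_to_square:
  assumes "triangle_circuit N G t"
  obtains s a where "square_circuit N G s" "circuit_op N s = circuit_op N t"
    "converts G a 0 t s" "a \<le> N ^ 3"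
proof -
  have t: "is_circuit N G t" "map fst t = cascades 1"
    using assms by (simp_all add: triangle_circuit_iff)
  have "reduces (N ^ 3) 0 (cascades 1) (layers 1 N)"
    using braids_square_triangle by (simp add: braids_def)
  from reducesE [OF this t] that show thesis
    unfolding square_circuit_def using alternating_circuit_layers by metis
qed

lemma length_square:
  assumes "square_circuit N G s"
  shows "length s = N * (N - 1) div 2"
proof -
  obtain t a where "triangle_circuit N G t" "converts G a 0 s t"
    using square_to_triangle [OF assms] by metis
  then show ?thesis
    using length_triangle converts_length by fastforce
qed

lemma triangle_merge:
  assumes t: "triangle_circuit N G t" and c: "is_circuit N G (u @ t @ v)"
    and r: "reduces a b (map fst u @ cascades 1 @ map fst v) (cascades 1)"
  obtains t' a' where "triangle_circuit N G t'"
    "circuit_op N t' = circuit_op N v * circuit_op N t * circuit_op N u"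
    "converts G a' b (u @ t @ v) t'" "a' \<le> a"
proof -
  have "map fst (u @ t @ v) = map fst u @ cascades 1 @ map fst v"
    using t by (simp add: triangle_circuit_iff)
  moreover have "circuit_op N (u @ t @ v) = circuit_op N v * circuit_op N t * circuit_op N u"
    using c by (simp add: circuit_op_append)
  ultimately show thesis
    using reducesE [OF r c] that unfolding triangle_circuit_iff by metis
qed

lemma triangle_merge_after:
  assumes t: "triangle_circuit N G t" and v: "is_circuit N G v"
    and r: "reduces a b (cascades 1 @ map fst v) (cascades 1)"
  obtains t' a' where "triangle_circuit N G t'" "circuit_op N t' = circuit_op N v * circuit_op N t"
    "converts G a' b (t @ v) t'" "a' \<le> a"
proof -
  have "is_circuit N G t"
    using t by (simp add: triangle_circuit_iff)
  with v have c: "is_circuit N G ([] @ t @ v)"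
    and "circuit_op N v * circuit_op N t * circuit_op N [] = circuit_op N v * circuit_op N t"
    using circuit_op_carrier by (auto intro!: right_mult_one_mat mult_carrier_mat)
  with triangle_merge [OF t c, of a b] r that show thesis
    by (metis append_Nil list.map(1))
qed

lemma triangle_merge_before:
  assumes t: "triangle_circuit N G t" and u: "is_circuit N G u"
    and r: "reduces a b (map fst u @ cascades 1) (cascades 1)"
  obtains t' a' where "triangle_circuit N G t'" "circuit_op N t' = circuit_op N t * circuit_op N u"
    "converts G a' b (u @ t) t'" "a' \<le> a"
proof -
  have t': "is_circuit N G t"
    using t by (simp add: triangle_circuit_iff)
  with u have c: "is_circuit N G (u @ t @ [])"
    by simp
  moreover have "circuit_op N [] * circuit_op N t * circuit_op N u = circuit_op N t * circuit_op N u"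
    using circuit_op_carrier [OF t'] by simp
  ultimately show thesis
    using triangle_merge [OF t c, of a b] r that by (metis append_Nil2 list.map(1))
qed

lemma positions_of_circuit: "is_circuit N G c \<Longrightarrow> set (map fst c) \<subseteq> {1..N - 1}"
  by (auto simp: is_circuit_def)

lemma layer_length:
  assumes "odd_layer N G l \<or> even_layer N G l"
  shows "is_circuit N G l" "length l \<le> N"
proof -
  show "is_circuit N G l"
    using assms by (auto simp: odd_layer_def even_layer_def)
  have "distinct (map fst l)"
    using assms by (auto simp: odd_layer_def even_layer_def)
  then have "length l = card (set (map fst l))"
    using distinct_card by fastforce
  also have "\<dots> \<le> card {1..N - 1}"
    using positions_of_circuit [OF \<open>is_circuit N G l\<close>] by (intro card_mono) auto
  finally show "length l \<le> N" by simp
qed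

lemma alternating_to_square:
  assumes "N \<le> n" "alternating_circuit N G n c"
  obtains s a b where "square_circuit N G s" "circuit_op N s = circuit_op N c" "converts G a b c s"
    "a + b \<le> 2 * N ^ 3 + 3 * (n * N ^ 2)"
proof -
  obtain d e where c: "c = d @ e" and d: "square_circuit N G d" and e: "is_circuit N G e"
      and len: "length e \<le> (n - N) * N"
    using alternating_circuit_split [of N "n - N" c] assms unfolding square_circuit_def by auto
  have dc: "is_circuit N G d"
    using d alternating_circuit_positions unfolding square_circuit_def by blast
  obtain t a1 where t: "triangle_circuit N G t" "circuit_op N t = circuit_op N d"
      "converts G a1 0 d t" "a1 \<le> N ^ 3"
    using square_to_triangle [OF d] by metis
  obtain t' a2 where t': "triangle_circuit N G t'" "circuit_op N t' = circuit_op N e * circuit_op N t"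
      "converts G a2 (length e) (t @ e) t'" "a2 \<le> 2 * N * length e"
    using triangle_merge_after [OF t(1) e]
      cascades_absorb_right [OF positions_of_circuit [OF e]] by (metis length_map)
  obtain s a3 where s: "square_circuit N G s" "circuit_op N s = circuit_op N t'"
      "converts G a3 0 t' s" "a3 \<le> N ^ 3"
    using triangle_to_square [OF t'(1)] by metis
  have "converts G a1 0 (d @ e) (t @ e)"
    using converts_context [OF t(3), of "[]" e] by simp
  from converts_trans [OF s(3) converts_trans [OF t'(3) this]]
  have conv: "converts G (a1 + a2 + a3) (length e) c s"
    by (simp add: c)
  have "length e \<le> n * N"
    using len by (meson diff_le_self le_trans mult_le_mono1)
  then have "2 * N * length e + length e \<le> 2 * N * (n * N) + n * N"
    by (intro add_mono mult_le_mono2)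
  moreover have "2 * N * (n * N) = 2 * (n * N ^ 2)"
    by (metis mult.assoc mult.left_commute power2_eq_square)
  moreover have "n * N \<le> n * N ^ 2"
    by (metis mult_le_mono2 le_square power2_eq_square)
  moreover have "a1 + a2 + a3 + l \<le> 2 * p + 3 * q"
    if "x + l \<le> y + r" "y = 2 * q" "r \<le> q" "a1 \<le> p" "a2 \<le> x" "a3 \<le> p" for l p q r x y
    using that by linarith
  ultimately have "a1 + a2 + a3 + length e \<le> 2 * N ^ 3 + 3 * (n * N ^ 2)"
    using t(4) t'(4) s(4) by blast
  then show thesis
    using that [OF s(1) _ conv] s(2) t'(2) t(2) circuit_op_append [OF dc e] by (simp add: c)
qed

end

theorem mainTheorem1:
  shows "\<exists>C::real. \<forall>N::nat. \<forall>G :: nat \<Rightarrow> complex mat set.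
    2 \<le> N \<and> gate_family N G \<and> allows_fusion N G \<and> allows_turnover N G \<longrightarrow>
      \<comment> \<open>(1)\<close>
      (\<forall>s. square_circuit N G s \<longrightarrow> length s = N * (N - 1) div 2) \<and>
      (\<forall>t. triangle_circuit N G t \<longrightarrow> length t = N * (N - 1) div 2) \<and>
      (\<forall>s. square_circuit N G s \<longrightarrow>
        (\<exists>t a. triangle_circuit N G t \<and> circuit_op N t = circuit_op N s \<and>
               converts G a 0 s t \<and> real a \<le> C * real N ^ 3)) \<and>
      (\<forall>t. triangle_circuit N G t \<longrightarrow>
        (\<exists>s a. square_circuit N G s \<and> circuit_op N s = circuit_op N t \<and>
               converts G a 0 t s \<and> real a \<le> C * real N ^ 3)) \<and>
      \<comment> \<open>(2)\<close>
      (\<forall>t. \<forall>i \<in> {1..N - 1}. \<forall>g \<in> G i. triangle_circuit N G t \<longrightarrow>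
        (\<exists>t' a. triangle_circuit N G t' \<and> circuit_op N t' = g * circuit_op N t \<and>
                converts G a 1 (t @ [(i, g)]) t' \<and> real a \<le> C * real N) \<and>
        (\<exists>t' a. triangle_circuit N G t' \<and> circuit_op N t' = circuit_op N t * g \<and>
                converts G a 1 ((i, g) # t) t' \<and> real a \<le> C * real N)) \<and>
      (\<forall>t l l'. triangle_circuit N G t \<and>
          (odd_layer N G l \<and> even_layer N G l' \<or> even_layer N G l \<and> odd_layer N G l') \<longrightarrow>
        (\<exists>t' a b. triangle_circuit N G t' \<and>
                  circuit_op N t' = circuit_op N (l @ l') * circuit_op N t \<and>
                  converts G a b (t @ l @ l') t' \<and> real (a + b) \<le> C * real N ^ 2) \<and>
        (\<exists>t' a b. triangle_circuit N G t' \<and>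
                  circuit_op N t' = circuit_op N t * circuit_op N (l @ l') \<and>
                  converts G a b (l @ l' @ t) t' \<and> real (a + b) \<le> C * real N ^ 2)) \<and>
      \<comment> \<open>(3)\<close>
      (\<forall>n\<^sub>t::nat. \<forall>c. real n\<^sub>t > real N / 2 \<and> alternating_circuit N G (2 * n\<^sub>t) c \<longrightarrow>
        (\<exists>s a b. square_circuit N G s \<and> arranged_in_depth N s \<and>
                 circuit_op N s = circuit_op N c \<and> converts G a b c s \<and>
                 real (a + b) \<le> C * (real N ^ 3 + real n\<^sub>t * real N ^ 2)))"
proof (intro exI [of _ "6 :: real"] allI impI, elim conjE)
  fix N :: nat and G :: "nat \<Rightarrow> complex mat set"
  assume "2 \<le> N" "gate_family N G" "allows_fusion N G" "allows_turnover N G"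
  then interpret gate_circuits N G
    by unfold_locales
  have N: "N \<le> N ^ 2"
    by (simp add: power2_eq_square)
  have cube: "real a \<le> 6 * real N ^ 3" if "a \<le> N ^ 3" for a
  proof -
    have "a \<le> 6 * N ^ 3" using that by simp
    then have "real a \<le> real (6 * N ^ 3)" by (rule of_nat_mono)
    then show ?thesis by simp
  qed
  have linear: "real a \<le> 6 * real N" if "a \<le> 2 * N * length [x]" for a and x :: "nat \<times> complex mat"
    using that by simp
  have square: "real (a + length (l @ l')) \<le> 6 * real N ^ 2"
    if "a \<le> 2 * N * length (l @ l')" "length l \<le> N" "length l' \<le> N" for a and l l' :: circuit
  proof -
    have len: "length (l @ l') \<le> 2 * N"
      using that by simp
    then have "2 * N * length (l @ l') \<le> 2 * N * (2 * N)"
      by (rule mult_le_mono2)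
    also have "\<dots> = 4 * N ^ 2"
      by (simp add: power2_eq_square)
    finally have "a + length (l @ l') \<le> 6 * N ^ 2"
      using that(1) len N by linarith
    then have "real (a + length (l @ l')) \<le> real (6 * N ^ 2)" by (rule of_nat_mono)
    then show ?thesis by simp
  qed
  show "(\<forall>s. square_circuit N G s \<longrightarrow> length s = N * (N - 1) div 2) \<and>
      (\<forall>t. triangle_circuit N G t \<longrightarrow> length t = N * (N - 1) div 2) \<and>
      (\<forall>s. square_circuit N G s \<longrightarrow>
        (\<exists>t a. triangle_circuit N G t \<and> circuit_op N t = circuit_op N s \<and>
               converts G a 0 s t \<and> real a \<le> 6 * real N ^ 3)) \<and>
      (\<forall>t. triangle_circuit N G t \<longrightarrow>
        (\<exists>s a. square_circuit N G s \<and> circuit_op N s = circuit_op N t \<and>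
               converts G a 0 t s \<and> real a \<le> 6 * real N ^ 3)) \<and>
      (\<forall>t. \<forall>i \<in> {1..N - 1}. \<forall>g \<in> G i. triangle_circuit N G t \<longrightarrow>
        (\<exists>t' a. triangle_circuit N G t' \<and> circuit_op N t' = g * circuit_op N t \<and>
                converts G a 1 (t @ [(i, g)]) t' \<and> real a \<le> 6 * real N) \<and>
        (\<exists>t' a. triangle_circuit N G t' \<and> circuit_op N t' = circuit_op N t * g \<and>
                converts G a 1 ((i, g) # t) t' \<and> real a \<le> 6 * real N)) \<and>
      (\<forall>t l l'. triangle_circuit N G t \<and>
          (odd_layer N G l \<and> even_layer N G l' \<or> even_layer N G l \<and> odd_layer N G l') \<longrightarrow>
        (\<exists>t' a b. triangle_circuit N G t' \<and>
                  circuit_op N t' = circuit_op N (l @ l') * circuit_op N t \<and>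
                  converts G a b (t @ l @ l') t' \<and> real (a + b) \<le> 6 * real N ^ 2) \<and>
        (\<exists>t' a b. triangle_circuit N G t' \<and>
                  circuit_op N t' = circuit_op N t * circuit_op N (l @ l') \<and>
                  converts G a b (l @ l' @ t) t' \<and> real (a + b) \<le> 6 * real N ^ 2)) \<and>
      (\<forall>n\<^sub>t::nat. \<forall>c. real n\<^sub>t > real N / 2 \<and> alternating_circuit N G (2 * n\<^sub>t) c \<longrightarrow>
        (\<exists>s a b. square_circuit N G s \<and> arranged_in_depth N s \<and>
                 circuit_op N s = circuit_op N c \<and> converts G a b c s \<and>
                 real (a + b) \<le> 6 * (real N ^ 3 + real n\<^sub>t * real N ^ 2)))"
  proof (intro conjI allI ballI impI, goal_cases)
    case (1 s)
    then show ?case by (rule length_square)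
  next
    case (2 t)
    then show ?case by (rule length_triangle)
  next
    case (3 s)
    then show ?case using square_to_triangle cube by metis
  next
    case (4 t)
    then show ?case using triangle_to_square cube by metis
  next
    case (5 t i g)
    then have c: "is_circuit N G [(i, g)]"
      by simp
    have r: "reduces (2 * N * length [(i, g)]) 1 (cascades 1 @ map fst [(i, g)]) (cascades 1)"
      using cascades_absorb_right [OF positions_of_circuit [OF c]] by simp
    obtain t' a where "triangle_circuit N G t'"
        "circuit_op N t' = circuit_op N [(i, g)] * circuit_op N t"
        "converts G a 1 (t @ [(i, g)]) t'" "a \<le> 2 * N * length [(i, g)]"
      using triangle_merge_after [OF 5(3) c r] by metis
    then show ?case
      using circuit_op_1 [OF c] linear by metis
  next
    case (6 t i g)
    then have c: "is_circuit N G [(i, g)]"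
      by simp
    have r: "reduces (2 * N * length [(i, g)]) 1 (map fst [(i, g)] @ cascades 1) (cascades 1)"
      using cascades_absorb_left [OF positions_of_circuit [OF c]] by simp
    obtain t' a where "triangle_circuit N G t'"
        "circuit_op N t' = circuit_op N t * circuit_op N [(i, g)]"
        "converts G a 1 ([(i, g)] @ t) t'" "a \<le> 2 * N * length [(i, g)]"
      using triangle_merge_before [OF 6(3) c r] by metis
    then show ?case
      using circuit_op_1 [OF c] linear by (metis append_Cons append_Nil)
  next
    case (7 t l l')
    then have l: "is_circuit N G (l @ l')" "length l \<le> N" "length l' \<le> N"
      using layer_length [of l] layer_length [of l'] by auto
    obtain t' a where "triangle_circuit N G t'"
        "circuit_op N t' = circuit_op N (l @ l') * circuit_op N t"
        "converts G a (length (l @ l')) (t @ l @ l') t'" "a \<le> 2 * N * length (l @ l')"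
      using triangle_merge_after [OF conjunct1 [OF 7] l(1)]
        cascades_absorb_right [OF positions_of_circuit [OF l(1)]] by (metis length_map)
    then show ?case
      using square l(2,3) by blast
  next
    case (8 t l l')
    then have l: "is_circuit N G (l @ l')" "length l \<le> N" "length l' \<le> N"
      using layer_length [of l] layer_length [of l'] by auto
    obtain t' a where "triangle_circuit N G t'"
        "circuit_op N t' = circuit_op N t * circuit_op N (l @ l')"
        "converts G a (length (l @ l')) ((l @ l') @ t) t'" "a \<le> 2 * N * length (l @ l')"
      using triangle_merge_before [OF conjunct1 [OF 8] l(1)]
        cascades_absorb_left [OF positions_of_circuit [OF l(1)]] by (metis length_map)
    then show ?case
      using square l(2,3) unfolding append_assoc by blast
  next
    case (9 n\<^sub>t c)
    then have "N \<le> 2 * n\<^sub>t" "alternating_circuit N G (2 * n\<^sub>t) c"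
      by simp_all
    then obtain s a b where s: "square_circuit N G s" "circuit_op N s = circuit_op N c"
        "converts G a b c s" "a + b \<le> 2 * N ^ 3 + 3 * (2 * n\<^sub>t * N ^ 2)"
      using alternating_to_square by metis
    have "a + b \<le> 6 * (N ^ 3 + n\<^sub>t * N ^ 2)"
      using s(4) by simp
    then have "real (a + b) \<le> real (6 * (N ^ 3 + n\<^sub>t * N ^ 2))"
      by (rule of_nat_mono)
    then have "real (a + b) \<le> 6 * (real N ^ 3 + real n\<^sub>t * real N ^ 2)"
      by simp
    with s square_circuit_arranged show ?case by blast
  qed
qed

end
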